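(* Let $\lambda_r>0$, $\lambda_t>0$ and $T>0$, and consider a protocol $P$ whose randomization intervals are i.i.d. $\mathrm{Exp}(\lambda_r)$ and whose transmission intervals are i.i.d. $\mathrm{Exp}(\lambda_t)$. Let $p_{\mathrm{mix}}(T)$ be the probability that two location-indistinguishable devices mix for protocol $P$ within duration $T$, allowing multiple randomizations during $T$. Put $B=\lambda_r+\lambda_t$ and $$p_{\mathrm{mix},1}^{\mathrm{ub}}(P)=\lambda_r\left(\frac{1}{B}+\frac{\lambda_t}{B^2}\right).$$ Then $$p_{\mathrm{mix}}(T)\;\le\;1-e^{-2\lambda_r T\, p_{\mathrm{mix},1}^{\mathrm{ub}}(P)}.$$
   Context: $\mathrm{Exp}(\lambda)$ denotes the exponential distribution with rate $\lambda$. Two devices run the same protocol $P$ and are location-indistinguishable during the whole time window $[0,T]$. Each device occasionally replaces its identifier by a fresh one ("randomizes" or "rotates") and occasionally transmits its current identifier, which is then seen by a passive adversary. For each device, the randomization times form a Poisson process of rate $\lambda_r$ on $[0,\infty)$ and the transmission times form a Poisson process of rate $\lambda_t$ on $[0,\infty)$ (i.e. i.i.d. exponential intervals); these four processes (two per device) are independent. Every randomization by either device at a time $s\le T$ is a mixing opportunity. Let $i$ be the device randomizing at time $s$ and $j$ the other device. Let $R'$ be the time of the first randomization of $j$ after $s$, let $T_1$ be the time of the first transmission of $i$ after $s$, and let $T_2$ be the time of the first transmission of $j$ after $T_1$. The devices mix at this opportunity if and only if $R'\le T$ and $T_2>R'$; that is, $j$ also randomizes within the window, and $j$ does not transmit its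 old identifier after $i$ has started transmitting its new one. The devices mix within duration $T$ if they mix at at least one mixing opportunity in $[0,T]$, and $p_{\mathrm{mix}}(T)$ is the probability of this event. *)

theory Defs
  imports "HOL-Probability.Probability"
begin

datatype device = Device1 | Device2

fun other :: "device \<Rightarrow> device" where
  "other Device1 = Device2"
| "other Device2 = Device1"

datatype activity = Randomize | Transmit

text \<open>
  A Poisson process of rate \<open>l\<close> on \<open>[0, \<infinity>)\<close> is represented by its sequence of
  i.i.d. exponential intervals; \<open>X 0\<close> is the waiting time from time \<open>0\<close> to the first point.
\<close>

definition iid_exponential :: "'a measure \<Rightarrow> real \<Rightarrow> (nat \<Rightarrow> 'a \<Rightarrow> real) \<Rightarrow> bool" where
  "iid_exponential M l X \<longleftrightarrow>
     prob_space.indep_vars M (\<lambda>_. borel) X UNIV \<and>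
     (\<forall>n. distributed M lborel (X n) (exponential_density l))"

definition arrival :: "(nat \<Rightarrow> 'a \<Rightarrow> real) \<Rightarrow> nat \<Rightarrow> 'a \<Rightarrow> real" where
  "arrival X n \<omega> = (\<Sum>k\<le>n. X k \<omega>)"

definition arrival_times :: "(nat \<Rightarrow> 'a \<Rightarrow> real) \<Rightarrow> 'a \<Rightarrow> real set" where
  "arrival_times X \<omega> = range (\<lambda>n. arrival X n \<omega>)"

text \<open>
  Independence of the processes is independence of the interval sequences as random
  elements of the product space \<open>nat \<Rightarrow> real\<close>.
\<close>

definition device_processes ::
    "'a measure \<Rightarrow> real \<Rightarrow> real \<Rightarrow> (device \<times> activity \<Rightarrow> nat \<Rightarrow> 'a \<Rightarrow> real) \<Rightarrow> bool" where
  "device_processes M l\<^sub>r l\<^sub>t X \<longleftrightarrow>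
     (\<forall>d. iid_exponential M l\<^sub>r (X (d, Randomize))) \<and>
     (\<forall>d. iid_exponential M l\<^sub>t (X (d, Transmit))) \<and>
     prob_space.indep_vars M (\<lambda>_. PiM UNIV (\<lambda>_. borel)) (\<lambda>p \<omega> n. X p n \<omega>) UNIV"

text \<open>
  The first point of \<open>A\<close> strictly after \<open>s\<close>, and \<open>\<infinity>\<close> if there is none. For the
  locally finite sets occurring almost surely below, the infimum is attained.
\<close>

definition next_after :: "real set \<Rightarrow> ereal \<Rightarrow> ereal" where
  "next_after A s = Inf {ereal t | t. t \<in> A \<and> s < ereal t}"

definition mixes_at ::
    "(device \<Rightarrow> real set) \<Rightarrow> (device \<Rightarrow> real set) \<Rightarrow> real \<Rightarrow> device \<Rightarrow> real \<Rightarrow> bool" where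
  "mixes_at R S T i s \<longleftrightarrow>
     (let j = other i;
          R' = next_after (R j) (ereal s);
          T\<^sub>1 = next_after (S i) (ereal s);
          T\<^sub>2 = next_after (S j) T\<^sub>1
      in R' \<le> ereal T \<and> T\<^sub>2 > R')"

definition mixes_within ::
    "(device \<Rightarrow> real set) \<Rightarrow> (device \<Rightarrow> real set) \<Rightarrow> real \<Rightarrow> bool" where
  "mixes_within R S T \<longleftrightarrow> (\<exists>i. \<exists>s \<in> R i \<inter> {0..T}. mixes_at R S T i s)"

definition mix_event ::
    "'a measure \<Rightarrow> (device \<times> activity \<Rightarrow> nat \<Rightarrow> 'a \<Rightarrow> real) \<Rightarrow> real \<Rightarrow> 'a set" where
  "mix_event M X T =
     {\<omega> \<in> space M. mixes_within (\<lambda>d. arrival_times (X (d, Randomize)) \<omega>)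
                                 (\<lambda>d. arrival_times (X (d, Transmit)) \<omega>) T}"

definition p_mix ::
    "'a measure \<Rightarrow> (device \<times> activity \<Rightarrow> nat \<Rightarrow> 'a \<Rightarrow> real) \<Rightarrow> real \<Rightarrow> real" where
  "p_mix M X T = measure M (mix_event M X T)"

definition p_mix1_ub :: "real \<Rightarrow> real \<Rightarrow> real" where
  "p_mix1_ub l\<^sub>r l\<^sub>t = (let B = l\<^sub>r + l\<^sub>t in l\<^sub>r * (1 / B + l\<^sub>t / B\<^sup>2))"

text \<open>
  The mixing event is measurable, so \<open>p_mix\<close> is a genuine probability (\<open>measure\<close>
  would return \<open>0\<close> on a non-measurable set).
\<close>

lemma next_after_range:
  "next_after (range a) s = (INF n. if s < ereal (a n) then ereal (a n) else \<infinity>)"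
  unfolding next_after_def
proof (rule antisym)
  show "Inf {ereal t |t. t \<in> range a \<and> s < ereal t}
      \<le> (INF n. if s < ereal (a n) then ereal (a n) else \<infinity>)"
    by (intro INF_greatest) (auto intro!: Inf_lower)
  show "(INF n. if s < ereal (a n) then ereal (a n) else \<infinity>)
      \<le> Inf {ereal t |t. t \<in> range a \<and> s < ereal t}"
  proof (intro Inf_greatest, clarify)
    fix n assume "s < ereal (a n)"
    then show "(INF n. if s < ereal (a n) then ereal (a n) else \<infinity>) \<le> ereal (a n)"
      by (intro INF_lower2[of n]) auto
  qed
qed

lemma measurable_next_after:
  assumes [measurable]: "\<And>n. X n \<in> borel_measurable M" "s \<in> borel_measurable M"
  shows "(\<lambda>\<omega>. next_after (arrival_times X \<omega>) (s \<omega>)) \<in> borel_measurable M"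
  unfolding arrival_times_def next_after_range arrival_def by measurable

lemma bex_device: "(\<exists>i. P i) \<longleftrightarrow> P Device1 \<or> P Device2"
  by (metis (full_types) device.exhaust)

lemma mix_event_sets:
  assumes X: "\<And>p n. X p n \<in> borel_measurable M"
  shows "mix_event M X T \<in> sets M"
proof -
  let ?R = "\<lambda>d. arrival_times (X (d, Randomize))"
  let ?S = "\<lambda>d. arrival_times (X (d, Transmit))"
  have [measurable]: "arrival (X p) n \<in> borel_measurable M" for p n
    unfolding arrival_def using X by measurable
  note [measurable] = measurable_next_after[OF X]
  have *: "{\<omega> \<in> space M. arrival (X (i, Randomize)) n \<omega> \<in> {0..T} \<and>
      mixes_at (\<lambda>d. ?R d \<omega>) (\<lambda>d. ?S d \<omega>) T i (arrival (X (i, Randomize)) n \<omega>)} \<in> sets M"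
    for i n
    unfolding mixes_at_def Let_def by measurable
  have "mix_event M X T =
    (\<Union>i\<in>{Device1, Device2}. \<Union>n. {\<omega> \<in> space M. arrival (X (i, Randomize)) n \<omega> \<in> {0..T} \<and>
      mixes_at (\<lambda>d. ?R d \<omega>) (\<lambda>d. ?S d \<omega>) T i (arrival (X (i, Randomize)) n \<omega>)})"
    unfolding mix_event_def mixes_within_def arrival_times_def
    by (auto simp: bex_device)
  then show ?thesis
    using * by auto
qed

lemma device_processes_mix_event_sets:
  assumes "device_processes M l\<^sub>r l\<^sub>t X"
  shows "mix_event M X T \<in> sets M"
proof (rule mix_event_sets)
  fix p :: "device \<times> activity" and n
  obtain d a where p: "p = (d, a)"
    by (cases p)
  have "distributed M lborel (X (d, Randomize) n) (exponential_density l\<^sub>r)"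
    "distributed M lborel (X (d, Transmit) n) (exponential_density l\<^sub>t)"
    using assms unfolding device_processes_def iid_exponential_def by blast+
  then show "X p n \<in> borel_measurable M"
    unfolding p by (cases a) (auto dest!: distributed_measurable)
qed

end

theory Submission
  imports Defs
begin

text \<open>
  The first ring of the four exponential clocks splits a path into a ringing time \<open>\<tau>\<close> with
  rate \<open>L = 2 * (l\<^sub>r + l\<^sub>t)\<close>, the process that rings, and a future that by memorylessness has the
  law of the original path. What matters from the past is only the pending mixing
  opportunity, one of three kinds up to symmetry, so the probabilities \<open>u c t\<close> of not mixing
  within \<open>t\<close> from state \<open>c\<close> satisfy a renewal inequality. With \<open>q = l\<^sub>t / (l\<^sub>r + l\<^sub>t)\<close>
  one has \<open>p_mix1_ub l\<^sub>r l\<^sub>t = 1 - q\<^sup>2\<close>, and \<open>1\<close>, \<open>q\<^sup>2\<close>, \<open>q\<close> times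
  \<open>exp (- 2 * l\<^sub>r * (1 - q\<^sup>2) * t)\<close> is a subsolution of the renewal equation. Since an event
  occurs before \<open>T\<close> with probability less than \<open>1\<close>, the equation is a contraction on
  \<open>[0, T]\<close> and the subsolution lies below \<open>u\<close>.
\<close>

section \<open>Exponential clocks and memorylessness\<close>

text \<open>
  Proved here because \<open>measurable_clocks_component\<close> below, whose conclusion unifies with
  every function application, would divert the measurability prover.
\<close>

lemma borel_measurable_exp_profile:
  fixes a L k g t :: real
  shows "(\<lambda>\<tau>. ennreal (a * exp (- L * \<tau>)) * ennreal (if t < \<tau> then 1 else k * exp (- g * (t - \<tau>)))
    * indicator {0<..} \<tau>) \<in> borel_measurable lborel"
  by measurable

definition expo :: "real \<Rightarrow> real measure" where
  "expo l = density lborel (exponential_density l)"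

definition gaps :: "real \<Rightarrow> (nat \<Rightarrow> real) measure" where
  "gaps l = PiM UNIV (\<lambda>_. expo l)"

text \<open>Canonical space of independent Poisson processes, coded by their interval sequences.
  Here memorylessness is a property of product measures, and a path is restarted by altering
  coordinates.\<close>

definition clocks :: "('i \<Rightarrow> real) \<Rightarrow> ('i \<Rightarrow> nat \<Rightarrow> real) measure" where
  "clocks rate = PiM UNIV (\<lambda>i. gaps (rate i))"

lemma sets_expo [measurable_cong]: "sets (expo l) = sets borel"
  by (simp add: expo_def)

lemma sets_gaps [measurable_cong]: "sets (gaps l) = sets (PiM UNIV (\<lambda>_. borel))"
  unfolding gaps_def by (intro sets_PiM_cong) (auto simp: sets_expo)

lemma sets_clocks [measurable_cong]:
  "sets (clocks rate) = sets (PiM UNIV (\<lambda>_. PiM UNIV (\<lambda>_. borel)))"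
  unfolding clocks_def by (intro sets_PiM_cong) (auto simp: sets_gaps)

lemma measurable_gaps_fun_upd [measurable (raw)]:
  assumes "f \<in> N \<rightarrow>\<^sub>M gaps l" "g \<in> borel_measurable N"
  shows "(\<lambda>x. (f x)(k := g x)) \<in> N \<rightarrow>\<^sub>M gaps l"
  using assms unfolding gaps_def
  by (intro measurable_fun_upd[where J = UNIV]) (auto simp: measurable_cong_sets[OF refl sets_expo])

lemma measurable_clocks_fun_upd [measurable (raw)]:
  assumes "f \<in> N \<rightarrow>\<^sub>M clocks rate" "g \<in> N \<rightarrow>\<^sub>M gaps (rate k)"
  shows "(\<lambda>x. (f x)(k := g x)) \<in> N \<rightarrow>\<^sub>M clocks rate"
  using assms unfolding clocks_def by (intro measurable_fun_upd[where J = UNIV]) auto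

lemma measurable_clocks_component [measurable (raw)]:
  assumes "f \<in> N \<rightarrow>\<^sub>M clocks rate"
  shows "(\<lambda>x. f x k) \<in> N \<rightarrow>\<^sub>M gaps (rate k)"
  using assms unfolding clocks_def by measurable

lemma measurable_gaps_component [measurable (raw)]:
  assumes "f \<in> N \<rightarrow>\<^sub>M gaps l"
  shows "(\<lambda>x. f x k) \<in> borel_measurable N"
  using measurable_compose[OF assms, of "\<lambda>z. z k" borel] by measurable

lemma space_clocks [simp]: "space (clocks rate) = UNIV"
  using sets_eq_imp_space_eq[OF sets_clocks] by (auto simp: space_PiM)

lemma prob_space_expo: "0 < l \<Longrightarrow> prob_space (expo l)"
  unfolding expo_def by (rule prob_space_exponential_density)

lemma prob_space_gaps: "0 < l \<Longrightarrow> prob_space (gaps l)"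
  unfolding gaps_def by (intro prob_space_PiM prob_space_expo)

lemma prob_space_clocks: "(\<And>i. 0 < rate i) \<Longrightarrow> prob_space (clocks rate)"
  unfolding clocks_def by (intro prob_space_PiM prob_space_gaps)

text \<open>Redrawing one coordinate independently leaves a product law unchanged. This serves as
  Fubini for coordinate \<open>k\<close> over an arbitrary index set.\<close>

lemma nn_integral_PiM_fun_upd:
  fixes M :: "'i \<Rightarrow> 'b measure"
  assumes M: "\<And>i. prob_space (M i)"
    and f [measurable]: "f \<in> borel_measurable (PiM UNIV M)"
  shows "(\<integral>\<^sup>+x. f x \<partial>PiM UNIV M) = (\<integral>\<^sup>+x. \<integral>\<^sup>+y. f (x(k := y)) \<partial>M k \<partial>PiM UNIV M)"
proof -
  interpret K: prob_space "M k" by (rule M)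
  interpret P: prob_space "PiM UNIV M" by (intro prob_space_PiM M)
  interpret KP: pair_sigma_finite "M k" "PiM UNIV M" ..
  have [measurable]: "(\<lambda>(x, X). X(k := x)) \<in> M k \<Otimes>\<^sub>M PiM UNIV M \<rightarrow>\<^sub>M PiM UNIV M"
    by (simp add: measurable_split_conv measurable_fun_upd[of UNIV UNIV k])
  have "(\<integral>\<^sup>+x. f x \<partial>PiM UNIV M)
      = (\<integral>\<^sup>+x. f x \<partial>distr (M k \<Otimes>\<^sub>M PiM UNIV M) (PiM UNIV M) (\<lambda>(x, X). X(k := x)))"
    using distr_pair_PiM_eq_PiM[of UNIV M k] M by simp
  also have "\<dots> = (\<integral>\<^sup>+p. f ((snd p)(k := fst p)) \<partial>(M k \<Otimes>\<^sub>M PiM UNIV M))"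
    by (subst nn_integral_distr) (auto simp: case_prod_unfold)
  also have "\<dots> = (\<integral>\<^sup>+x. \<integral>\<^sup>+y. f (x(k := y)) \<partial>M k \<partial>PiM UNIV M)"
    by (subst KP.nn_integral_snd[symmetric]) (auto simp: case_prod_unfold)
  finally show ?thesis .
qed

text \<open>The density vanishes on the negative axis and the point 0 is null; removing it makes
  every later ringing time strictly positive.\<close>

lemma nn_integral_expo:
  assumes l: "0 < l" and [measurable]: "f \<in> borel_measurable borel"
  shows "(\<integral>\<^sup>+y. f y \<partial>expo l)
    = (\<integral>\<^sup>+y. ennreal (l * exp (- l * y)) * f y * indicator {0<..} y \<partial>lborel)"
proof -
  have "(\<integral>\<^sup>+y. f y \<partial>expo l) = (\<integral>\<^sup>+y. ennreal (exponential_density l y) * f y \<partial>lborel)"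
    unfolding expo_def by (subst nn_integral_density) auto
  also have "\<dots> = (\<integral>\<^sup>+y. ennreal (l * exp (- l * y)) * f y * indicator {0<..} y \<partial>lborel)"
    using AE_lborel_singleton[of 0]
    by (intro nn_integral_cong_AE)
       (auto elim!: eventually_mono simp: exponential_density_def indicator_def mult.commute)
  finally show ?thesis .
qed

text \<open>Substitute \<open>y + \<tau>\<close> for \<open>y\<close>; the density then splits off
  the factor \<open>exp (- l * \<tau>)\<close>.\<close>

lemma nn_integral_expo_memoryless:
  assumes l: "0 < l" and \<tau>: "0 \<le> \<tau>" and [measurable]: "f \<in> borel_measurable borel"
  shows "(\<integral>\<^sup>+y. f y * indicator {\<tau><..} y \<partial>expo l)
    = ennreal (exp (- l * \<tau>)) * (\<integral>\<^sup>+y. f (y + \<tau>) \<partial>expo l)"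
proof -
  have "(\<integral>\<^sup>+y. f y * indicator {\<tau><..} y \<partial>expo l)
      = (\<integral>\<^sup>+y. ennreal (l * exp (- l * y)) * (f y * indicator {\<tau><..} y) * indicator {0<..} y \<partial>lborel)"
    by (rule nn_integral_expo[OF l]) measurable
  also have "\<dots> = (\<integral>\<^sup>+y. ennreal (l * exp (- l * (\<tau> + 1 * y)))
      * (f (\<tau> + 1 * y) * indicator {\<tau><..} (\<tau> + 1 * y)) * indicator {0<..} (\<tau> + 1 * y) \<partial>lborel)"
    by (subst nn_integral_real_affine[where c = 1 and t = \<tau>]) auto
  also have "\<dots> = (\<integral>\<^sup>+y. ennreal (exp (- l * \<tau>))
      * (ennreal (l * exp (- l * y)) * f (y + \<tau>) * indicator {0<..} y) \<partial>lborel)"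
  proof (intro nn_integral_cong)
    fix y :: real
    have "ennreal (l * exp (- l * (\<tau> + y))) = ennreal (exp (- l * \<tau>)) * ennreal (l * exp (- l * y))"
      using l by (subst ennreal_mult[symmetric]) (auto simp: algebra_simps exp_add exp_diff exp_minus divide_inverse)
    then show "ennreal (l * exp (- l * (\<tau> + 1 * y))) * (f (\<tau> + 1 * y) * indicator {\<tau><..} (\<tau> + 1 * y))
        * indicator {0<..} (\<tau> + 1 * y)
      = ennreal (exp (- l * \<tau>)) * (ennreal (l * exp (- l * y)) * f (y + \<tau>) * indicator {0<..} y)"
      using \<tau> by (simp add: indicator_def add.commute mult.assoc)
  qed
  also have "\<dots> = ennreal (exp (- l * \<tau>)) * (\<integral>\<^sup>+y. f (y + \<tau>) \<partial>expo l)"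
    by (subst nn_integral_cmult) (auto simp: nn_integral_expo[OF l])
  finally show ?thesis .
qed

lemma measurable_case_nat_gaps [measurable (raw)]:
  assumes "f \<in> borel_measurable N" "g \<in> N \<rightarrow>\<^sub>M gaps l"
  shows "(\<lambda>x. case_nat (f x) (g x)) \<in> N \<rightarrow>\<^sub>M gaps l"
  using assms unfolding measurable_cong_sets[OF refl sets_gaps] by (rule measurable_case_nat')

lemma nn_integral_gaps_case_nat:
  assumes l: "0 < l" and [measurable]: "f \<in> borel_measurable (gaps l)"
  shows "(\<integral>\<^sup>+z. f z \<partial>gaps l) = (\<integral>\<^sup>+z. \<integral>\<^sup>+a. f (case_nat a z) \<partial>expo l \<partial>gaps l)"
proof -
  interpret E: prob_space "expo l" using l by (rule prob_space_expo)
  interpret S: sequence_space "expo l" ..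
  interpret G: prob_space "gaps l" using l by (rule prob_space_gaps)
  interpret EG: pair_sigma_finite "expo l" "gaps l" ..
  have "(\<integral>\<^sup>+z. f z \<partial>gaps l)
      = (\<integral>\<^sup>+z. f z \<partial>distr (expo l \<Otimes>\<^sub>M gaps l) (gaps l) (\<lambda>(a, z). case_nat a z))"
    using S.PiM_iter by (simp add: gaps_def)
  also have "\<dots> = (\<integral>\<^sup>+p. f (case_nat (fst p) (snd p)) \<partial>(expo l \<Otimes>\<^sub>M gaps l))"
    by (subst nn_integral_distr) (auto simp: case_prod_unfold)
  also have "\<dots> = (\<integral>\<^sup>+z. \<integral>\<^sup>+a. f (case_nat a z) \<partial>expo l \<partial>gaps l)"
    by (subst EG.nn_integral_snd[symmetric]) (auto simp: case_prod_unfold)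
  finally show ?thesis .
qed

text \<open>The condition concerns interval 0 alone, which is independent of the later ones.
  Lengthening it by \<tau> translates every point of the process, since points are partial
  sums.\<close>

lemma nn_integral_gaps_memoryless:
  assumes l: "0 < l" and \<tau>: "0 \<le> \<tau>" and [measurable]: "f \<in> borel_measurable (gaps l)"
  shows "(\<integral>\<^sup>+z. f z * indicator {\<tau><..} (z 0) \<partial>gaps l)
    = ennreal (exp (- l * \<tau>)) * (\<integral>\<^sup>+z. f (z(0 := z 0 + \<tau>)) \<partial>gaps l)"
proof -
  interpret prob_space "expo l" using l by (rule prob_space_expo)
  have upd: "(\<integral>\<^sup>+z. g z \<partial>gaps l) = (\<integral>\<^sup>+z. \<integral>\<^sup>+y. g (z(0 := y)) \<partial>expo l \<partial>gaps l)"
    if "g \<in> borel_measurable (gaps l)" for g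
    using nn_integral_PiM_fun_upd[of "\<lambda>_. expo l" g 0] prob_space_expo[OF l] that
    unfolding gaps_def by auto
  have "(\<integral>\<^sup>+z. f z * indicator {\<tau><..} (z 0) \<partial>gaps l)
      = (\<integral>\<^sup>+z. \<integral>\<^sup>+y. f (z(0 := y)) * indicator {\<tau><..} y \<partial>expo l \<partial>gaps l)"
    by (subst upd) auto
  also have "\<dots> = (\<integral>\<^sup>+z. ennreal (exp (- l * \<tau>)) * (\<integral>\<^sup>+y. f (z(0 := y + \<tau>)) \<partial>expo l) \<partial>gaps l)"
    by (intro nn_integral_cong nn_integral_expo_memoryless l \<tau>) measurable
  also have "\<dots> = ennreal (exp (- l * \<tau>)) * (\<integral>\<^sup>+z. f (z(0 := z 0 + \<tau>)) \<partial>gaps l)"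
    by (subst (2) upd) (auto intro!: nn_integral_cmult)
  finally show ?thesis .
qed

section \<open>Restarting the clocks at the first ring\<close>

definition delay :: "'i set \<Rightarrow> real \<Rightarrow> ('i \<Rightarrow> nat \<Rightarrow> real) \<Rightarrow> 'i \<Rightarrow> nat \<Rightarrow> real" where
  "delay J \<tau> x = (\<lambda>j. if j \<in> J then (x j)(0 := x j 0 + \<tau>) else x j)"

text \<open>The path whose restart at \<tau> is \<open>x\<close>: clock \<open>p\<close> rings at
  \<tau>, so \<tau> becomes a complete interval of \<open>p\<close>, while the running interval of
  every other clock only gets longer.\<close>

definition prepend_event :: "'i \<Rightarrow> real \<Rightarrow> ('i \<Rightarrow> nat \<Rightarrow> real) \<Rightarrow> 'i \<Rightarrow> nat \<Rightarrow> real" where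
  "prepend_event p \<tau> x = (delay (- {p}) \<tau> x)(p := case_nat \<tau> (x p))"

lemma measurable_delay [measurable (raw)]:
  assumes [measurable]: "g \<in> borel_measurable N" "f \<in> N \<rightarrow>\<^sub>M clocks rate"
  shows "(\<lambda>x. delay J (g x) (f x)) \<in> N \<rightarrow>\<^sub>M clocks rate"
  unfolding clocks_def
proof (rule measurable_PiM_single')
  show "(\<lambda>x. delay J (g x) (f x) j) \<in> N \<rightarrow>\<^sub>M gaps (rate j)" for j
    unfolding delay_def by (cases "j \<in> J") simp_all
qed (auto simp: gaps_def expo_def space_PiM)

lemma measurable_prepend_event [measurable (raw)]:
  assumes [measurable]: "g \<in> borel_measurable N" "f \<in> N \<rightarrow>\<^sub>M clocks rate"
  shows "(\<lambda>x. prepend_event p (g x) (f x)) \<in> N \<rightarrow>\<^sub>M clocks rate"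
  unfolding prepend_event_def by measurable

lemma nn_integral_clocks_fun_upd:
  assumes rate: "\<And>i. 0 < rate i" and [measurable]: "f \<in> borel_measurable (clocks rate)"
  shows "(\<integral>\<^sup>+x. f x \<partial>clocks rate) = (\<integral>\<^sup>+x. \<integral>\<^sup>+z. f (x(k := z)) \<partial>gaps (rate k) \<partial>clocks rate)"
  using nn_integral_PiM_fun_upd[of "\<lambda>i. gaps (rate i)" f k] prob_space_gaps[OF rate] assms
  unfolding clocks_def by auto

lemma nn_integral_clocks_memoryless1:
  assumes rate: "\<And>i. 0 < rate i" and \<tau>: "0 \<le> \<tau>"
    and [measurable]: "f \<in> borel_measurable (clocks rate)"
  shows "(\<integral>\<^sup>+x. f x * indicator {\<tau><..} (x k 0) \<partial>clocks rate)
    = ennreal (exp (- rate k * \<tau>)) * (\<integral>\<^sup>+x. f (x(k := (x k)(0 := x k 0 + \<tau>))) \<partial>clocks rate)"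
proof -
  interpret prob_space "gaps (rate k)" using rate by (rule prob_space_gaps)
  have "(\<integral>\<^sup>+x. f x * indicator {\<tau><..} (x k 0) \<partial>clocks rate)
      = (\<integral>\<^sup>+x. \<integral>\<^sup>+z. f (x(k := z)) * indicator {\<tau><..} (z 0) \<partial>gaps (rate k) \<partial>clocks rate)"
    by (subst nn_integral_clocks_fun_upd[OF rate, where k = k]) auto
  also have "\<dots> = (\<integral>\<^sup>+x. ennreal (exp (- rate k * \<tau>)) *
      (\<integral>\<^sup>+z. f (x(k := z(0 := z 0 + \<tau>))) \<partial>gaps (rate k)) \<partial>clocks rate)"
    by (intro nn_integral_cong nn_integral_gaps_memoryless rate \<tau>) measurable
  also have "\<dots> = ennreal (exp (- rate k * \<tau>)) *
      (\<integral>\<^sup>+x. f (x(k := (x k)(0 := x k 0 + \<tau>))) \<partial>clocks rate)"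
    by (subst (2) nn_integral_clocks_fun_upd[OF rate, where k = k]) (auto intro!: nn_integral_cmult)
  finally show ?thesis .
qed

lemma nn_integral_clocks_memoryless:
  assumes rate: "\<And>i. 0 < rate i" and \<tau>: "0 \<le> \<tau>" and "finite J"
    and "f \<in> borel_measurable (clocks rate)"
  shows "(\<integral>\<^sup>+x. f x * (\<Prod>j\<in>J. indicator {\<tau><..} (x j 0)) \<partial>clocks rate)
    = ennreal (exp (- (\<Sum>j\<in>J. rate j) * \<tau>)) * (\<integral>\<^sup>+x. f (delay J \<tau> x) \<partial>clocks rate)"
  using assms(3,4)
proof (induction J arbitrary: f rule: finite_induct)
  case empty
  then show ?case by (simp add: delay_def)
next
  case (insert k J)
  note [measurable] = \<open>f \<in> borel_measurable (clocks rate)\<close>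
  \<comment> \<open>The indicator of clock \<open>k\<close> is absorbed into the integrand. The
    induction hypothesis, valid for every integrand, carries it along because \<open>delay J\<close>
    does not touch clock \<open>k\<close>.\<close>
  have "(\<integral>\<^sup>+x. f x * (\<Prod>j\<in>insert k J. indicator {\<tau><..} (x j 0)) \<partial>clocks rate)
      = (\<integral>\<^sup>+x. (f x * indicator {\<tau><..} (x k 0)) * (\<Prod>j\<in>J. indicator {\<tau><..} (x j 0)) \<partial>clocks rate)"
    using insert by (simp add: mult.assoc)
  also have "\<dots> = ennreal (exp (- (\<Sum>j\<in>J. rate j) * \<tau>)) *
      (\<integral>\<^sup>+x. f (delay J \<tau> x) * indicator {\<tau><..} (x k 0) \<partial>clocks rate)"
    using insert.hyps by (subst insert.IH) (auto simp: delay_def)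
  also have "\<dots> = ennreal (exp (- (\<Sum>j\<in>J. rate j) * \<tau>)) * (ennreal (exp (- rate k * \<tau>)) *
      (\<integral>\<^sup>+x. f (delay J \<tau> (x(k := (x k)(0 := x k 0 + \<tau>)))) \<partial>clocks rate))"
    by (subst nn_integral_clocks_memoryless1[OF rate \<tau>]) auto
  also have "(\<lambda>x. f (delay J \<tau> (x(k := (x k)(0 := x k 0 + \<tau>))))) = (\<lambda>x. f (delay (insert k J) \<tau> x))"
    using insert.hyps by (auto simp: delay_def fun_eq_iff intro!: arg_cong[where f = f])
  finally have "(\<integral>\<^sup>+x. f x * (\<Prod>j\<in>insert k J. indicator {\<tau><..} (x j 0)) \<partial>clocks rate)
      = ennreal (exp (- (\<Sum>j\<in>J. rate j) * \<tau>)) * ennreal (exp (- rate k * \<tau>)) *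
        (\<integral>\<^sup>+x. f (delay (insert k J) \<tau> x) \<partial>clocks rate)"
    by (simp only: mult.assoc)
  also have "ennreal (exp (- (\<Sum>j\<in>J. rate j) * \<tau>)) * ennreal (exp (- rate k * \<tau>))
      = ennreal (exp (- (\<Sum>j\<in>insert k J. rate j) * \<tau>))"
    using insert.hyps by (simp add: ennreal_mult[symmetric] exp_add[symmetric] algebra_simps)
  finally show ?case .
qed

lemma nn_integral_clocks_case_nat:
  assumes rate: "\<And>i. 0 < rate i" and [measurable]: "f \<in> borel_measurable (clocks rate)"
  shows "(\<integral>\<^sup>+x. f x \<partial>clocks rate)
    = (\<integral>\<^sup>+a. \<integral>\<^sup>+x. f (x(p := case_nat a (x p))) \<partial>clocks rate \<partial>expo (rate p))"
proof -
  interpret E: prob_space "expo (rate p)" using rate by (rule prob_space_expo)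
  interpret C: prob_space "clocks rate" using rate by (rule prob_space_clocks)
  interpret EC: pair_sigma_finite "expo (rate p)" "clocks rate" ..
  have "(\<integral>\<^sup>+x. f x \<partial>clocks rate)
      = (\<integral>\<^sup>+x. \<integral>\<^sup>+z. f (x(p := z)) \<partial>gaps (rate p) \<partial>clocks rate)"
    by (rule nn_integral_clocks_fun_upd[OF rate]) measurable
  also have "\<dots> = (\<integral>\<^sup>+x. \<integral>\<^sup>+z. \<integral>\<^sup>+a. f (x(p := case_nat a z)) \<partial>expo (rate p) \<partial>gaps (rate p) \<partial>clocks rate)"
    by (intro nn_integral_cong nn_integral_gaps_case_nat rate) measurable
  also have "\<dots> = (\<integral>\<^sup>+x. \<integral>\<^sup>+a. f (x(p := case_nat a (x p))) \<partial>expo (rate p) \<partial>clocks rate)"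
    by (subst (2) nn_integral_clocks_fun_upd[OF rate, where k = p]) auto
  also have "\<dots> = (\<integral>\<^sup>+a. \<integral>\<^sup>+x. f (x(p := case_nat a (x p))) \<partial>clocks rate \<partial>expo (rate p))"
    by (rule EC.Fubini') measurable
  finally show ?thesis .
qed

lemma measurable_indicator_greaterThan [measurable (raw)]:
  fixes f g :: "'b \<Rightarrow> real"
  assumes [measurable]: "f \<in> borel_measurable N" "g \<in> borel_measurable N"
  shows "(\<lambda>x. indicator {f x<..} (g x) :: ennreal) \<in> borel_measurable N"
  unfolding indicator_def greaterThan_iff by measurable

text \<open>Draw the first interval of \<open>p\<close> as \<tau>. The other clocks all exceed
  \<tau> with probability \<open>exp (- (\<Sum>j\<in>- {p}. rate j) * \<tau>)\<close> and are then
  delayed copies of fresh clocks; with the density of \<tau> the exponents add up to the total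
  rate.\<close>

lemma nn_integral_clocks_first_event:
  assumes rate: "\<And>i. 0 < rate i" and fin: "finite (UNIV :: 'i set)"
    and [measurable]: "f \<in> borel_measurable (clocks (rate :: 'i \<Rightarrow> real))"
  shows "(\<integral>\<^sup>+x. f x * (\<Prod>j\<in>- {p}. indicator {x p 0<..} (x j 0)) \<partial>clocks rate)
    = (\<integral>\<^sup>+\<tau>. ennreal (rate p * exp (- (\<Sum>j\<in>UNIV. rate j) * \<tau>)) *
        (\<integral>\<^sup>+x. f (prepend_event p \<tau> x) \<partial>clocks rate) * indicator {0<..} \<tau> \<partial>lborel)"
proof -
  interpret C: prob_space "clocks rate" using rate by (rule prob_space_clocks)
  have fin': "finite (- {p})"
    using fin by (rule finite_subset[rotated]) auto
  have "(\<integral>\<^sup>+x. f x * (\<Prod>j\<in>- {p}. indicator {x p 0<..} (x j 0)) \<partial>clocks rate)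
      = (\<integral>\<^sup>+\<tau>. \<integral>\<^sup>+x. f (x(p := case_nat \<tau> (x p))) * (\<Prod>j\<in>- {p}. indicator {\<tau><..} (x j 0))
          \<partial>clocks rate \<partial>expo (rate p))"
    by (subst nn_integral_clocks_case_nat[OF rate, where p = p]) (auto intro!: nn_integral_cong prod.cong)
  also have "\<dots> = (\<integral>\<^sup>+\<tau>. ennreal (rate p * exp (- rate p * \<tau>)) *
      (\<integral>\<^sup>+x. f (x(p := case_nat \<tau> (x p))) * (\<Prod>j\<in>- {p}. indicator {\<tau><..} (x j 0)) \<partial>clocks rate)
      * indicator {0<..} \<tau> \<partial>lborel)"
    by (rule nn_integral_expo[OF rate]) measurable
  also have "\<dots> = (\<integral>\<^sup>+\<tau>. ennreal (rate p * exp (- (\<Sum>j\<in>UNIV. rate j) * \<tau>)) *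
        (\<integral>\<^sup>+x. f (prepend_event p \<tau> x) \<partial>clocks rate) * indicator {0<..} \<tau> \<partial>lborel)"
  proof (rule nn_integral_cong)
    fix \<tau> :: real
    have sum: "(\<Sum>j\<in>UNIV. rate j) = rate p + (\<Sum>j\<in>- {p}. rate j)"
      using sum.remove[OF fin, of p rate] by (simp add: Compl_eq_Diff_UNIV)
    \<comment> \<open>The memoryless lemma delays before \<tau> is put in front of \<open>p\<close>.
      As the delay spares \<open>p\<close>, the result is \<open>prepend_event\<close>.\<close>
    have *: "f ((delay (- {p}) \<tau> x)(p := case_nat \<tau> (delay (- {p}) \<tau> x p))) = f (prepend_event p \<tau> x)" for x
      by (simp add: prepend_event_def delay_def)
    show "ennreal (rate p * exp (- rate p * \<tau>)) *
      (\<integral>\<^sup>+x. f (x(p := case_nat \<tau> (x p))) * (\<Prod>j\<in>- {p}. indicator {\<tau><..} (x j 0)) \<partial>clocks rate)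
      * indicator {0<..} \<tau> = ennreal (rate p * exp (- (\<Sum>j\<in>UNIV. rate j) * \<tau>)) *
        (\<integral>\<^sup>+x. f (prepend_event p \<tau> x) \<partial>clocks rate) * indicator {0<..} \<tau>"
    proof (cases "0 < \<tau>")
      case True
      have "rate p * exp (- (\<Sum>j\<in>UNIV. rate j) * \<tau>)
          = (rate p * exp (- rate p * \<tau>)) * exp (- (\<Sum>j\<in>- {p}. rate j) * \<tau>)"
        unfolding sum by (simp add: exp_add[symmetric] algebra_simps)
      then have split: "ennreal (rate p * exp (- (\<Sum>j\<in>UNIV. rate j) * \<tau>))
          = ennreal (rate p * exp (- rate p * \<tau>)) * ennreal (exp (- (\<Sum>j\<in>- {p}. rate j) * \<tau>))"
        using rate[of p] by (simp only: ennreal_mult less_imp_le mult_nonneg_nonneg exp_ge_zero)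
      have mem: "(\<integral>\<^sup>+x. f (x(p := case_nat \<tau> (x p))) * (\<Prod>j\<in>- {p}. indicator {\<tau><..} (x j 0)) \<partial>clocks rate)
          = ennreal (exp (- (\<Sum>j\<in>- {p}. rate j) * \<tau>)) * (\<integral>\<^sup>+x. f (prepend_event p \<tau> x) \<partial>clocks rate)"
        using True by (subst nn_integral_clocks_memoryless[OF rate _ fin']) (auto simp: *)
      show ?thesis
        by (simp only: mem split mult.assoc)
    qed simp
  qed
  finally show ?thesis .
qed

text \<open>At most one clock rings strictly before all others, so the indicators of these events
  sum to at most 1. This is the renewal inequality in the direction that lower bounds on survival
  use.\<close>

lemma nn_integral_clocks_ge_first_event:
  assumes rate: "\<And>i. 0 < rate i" and fin: "finite (UNIV :: 'i set)"
    and [measurable]: "f \<in> borel_measurable (clocks (rate :: 'i \<Rightarrow> real))"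
  shows "(\<Sum>p\<in>UNIV. \<integral>\<^sup>+\<tau>. ennreal (rate p * exp (- (\<Sum>j\<in>UNIV. rate j) * \<tau>)) *
        (\<integral>\<^sup>+x. f (prepend_event p \<tau> x) \<partial>clocks rate) * indicator {0<..} \<tau> \<partial>lborel)
    \<le> (\<integral>\<^sup>+x. f x \<partial>clocks rate)"
proof -
  let ?first = "\<lambda>p (x :: 'i \<Rightarrow> nat \<Rightarrow> real). \<Prod>j\<in>- {p}. indicator {x p 0<..} (x j 0) :: ennreal"
  have le_1: "(\<Sum>p\<in>UNIV. ?first p x) \<le> 1" for x
  proof (cases "\<exists>p. ?first p x \<noteq> 0")
    case True
    then obtain p where p: "?first p x \<noteq> 0" by blast
    have fin': "finite (- {q})" for q :: 'i
      using fin by (rule finite_subset[rotated]) auto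
    have "?first q x = 0" if "q \<noteq> p" for q
    proof -
      have "x p 0 < x q 0"
        using p that fin'[of p] by (auto simp: indicator_def split: if_splits)
      then show ?thesis
        using that fin'[of q] by (auto simp: indicator_def intro!: bexI[of _ p])
    qed
    then have "(\<Sum>q\<in>UNIV. ?first q x) = (\<Sum>q\<in>{p}. ?first q x)"
      using fin by (intro sum.mono_neutral_right) auto
    also have "\<dots> \<le> 1"
      by (auto intro!: prod_le_1 simp: indicator_def)
    finally show ?thesis .
  next
    case False
    then have "\<forall>p. ?first p x = 0" by blast
    then show ?thesis by (simp only: sum.neutral_const) simp
  qed
  have "(\<Sum>p\<in>UNIV. \<integral>\<^sup>+\<tau>. ennreal (rate p * exp (- (\<Sum>j\<in>UNIV. rate j) * \<tau>)) *
        (\<integral>\<^sup>+x. f (prepend_event p \<tau> x) \<partial>clocks rate) * indicator {0<..} \<tau> \<partial>lborel)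
      = (\<Sum>p\<in>UNIV. \<integral>\<^sup>+x. f x * ?first p x \<partial>clocks rate)"
    by (intro sum.cong refl nn_integral_clocks_first_event[symmetric] rate fin) measurable
  also have "\<dots> = (\<integral>\<^sup>+x. (\<Sum>p\<in>UNIV. f x * ?first p x) \<partial>clocks rate)"
    by (rule nn_integral_sum[symmetric]) measurable
  also have "\<dots> \<le> (\<integral>\<^sup>+x. f x \<partial>clocks rate)"
  proof (rule nn_integral_mono)
    fix x
    have "(\<Sum>p\<in>UNIV. f x * ?first p x) = f x * (\<Sum>p\<in>UNIV. ?first p x)"
      by (rule sum_distrib_left[symmetric])
    also have "\<dots> \<le> f x * 1"
      by (intro mult_left_mono le_1) simp
    finally show "(\<Sum>p\<in>UNIV. f x * ?first p x) \<le> f x"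
      by simp
  qed
  finally show ?thesis .
qed

section \<open>Pending mixing opportunities\<close>

text \<open>
  As long as the devices have not mixed, at most one past mixing opportunity matters: it belongs
  to the device \<open>i\<close> that randomized last, and the argument of \<open>Fresh\<close> and \<open>Half\<close> is this \<open>i\<close>. In
  state \<open>Fresh i\<close> it has not transmitted its new identifier yet; in state \<open>Half i\<close> it has,
  but the other device has not transmitted since.
\<close>

datatype pending = Idle | Fresh device | Half device

text \<open>Time 0 is the present. In state \<open>Half i\<close> the time T_1 is past and the other
  device has not transmitted since, so T_2 is its first transmission after 0.\<close>

definition mixes_from :: "pending \<Rightarrow> (device \<times> activity \<Rightarrow> real set) \<Rightarrow> real \<Rightarrow> bool" where
  "mixes_from c A t \<longleftrightarrow>
     mixes_within (\<lambda>d. A (d, Randomize)) (\<lambda>d. A (d, Transmit)) t \<or>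
     (case c of
        Idle \<Rightarrow> False
      | Fresh i \<Rightarrow> mixes_at (\<lambda>d. A (d, Randomize)) (\<lambda>d. A (d, Transmit)) t i 0
      | Half i \<Rightarrow> next_after (A (other i, Randomize)) 0 \<le> ereal t \<and>
          next_after (A (other i, Randomize)) 0 < next_after (A (other i, Transmit)) 0)"

text \<open>\<open>None\<close> stands for the devices having mixed.\<close>

fun pending_after :: "pending \<Rightarrow> device \<times> activity \<Rightarrow> pending option" where
  "pending_after Idle (d, Randomize) = Some (Fresh d)"
| "pending_after Idle (d, Transmit) = Some Idle"
| "pending_after (Fresh i) (d, Randomize) = (if d = i then Some (Fresh i) else None)"
| "pending_after (Fresh i) (d, Transmit) = Some (if d = i then Half i else Fresh i)"
| "pending_after (Half i) (d, Randomize) = (if d = i then Some (Fresh i) else None)"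
| "pending_after (Half i) (d, Transmit) = Some (if d = i then Half i else Idle)"

definition prepend_point ::
    "'i \<Rightarrow> real \<Rightarrow> ('i \<Rightarrow> real set) \<Rightarrow> 'i \<Rightarrow> real set" where
  "prepend_point p \<tau> A = (\<lambda>j. (+) \<tau> ` A j \<union> (if j = p then {\<tau>} else {}))"

section \<open>First points after a given time, and translation\<close>

lemma next_after_insert:
  "next_after (insert a A) s = (if s < ereal a then min (ereal a) (next_after A s) else next_after A s)"
proof -
  have "{ereal t |t. t \<in> insert a A \<and> s < ereal t} =
    (if s < ereal a then insert (ereal a) else id) {ereal t |t. t \<in> A \<and> s < ereal t}"
    by auto
  then show ?thesis
    unfolding next_after_def by (auto simp: inf_min)
qed

lemma next_after_mono: "s \<le> s' \<Longrightarrow> next_after A s \<le> next_after A s'"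
  unfolding next_after_def by (intro Inf_superset_mono) auto

lemma next_after_gt_eq:
  assumes "\<And>a. a \<in> A \<Longrightarrow> s' < ereal a" "s \<le> s'"
  shows "next_after A s = next_after A s'"
proof -
  have "{ereal t |t. t \<in> A \<and> s < ereal t} = {ereal t |t. t \<in> A \<and> s' < ereal t}"
    using assms by (auto intro: le_less_trans)
  then show ?thesis by (simp add: next_after_def)
qed

text \<open>Since \<tau> is finite, it can be subtracted again, which gives the first half. The set
  \<open>S\<close> may be empty, with infimum \<infinity>.\<close>

lemma Inf_add_ereal: "Inf ((\<lambda>e. e + ereal \<tau>) ` S) = Inf S + ereal \<tau>"
proof (rule antisym)
  have "Inf ((\<lambda>e. e + ereal \<tau>) ` S) - ereal \<tau> \<le> Inf S"
  proof (rule Inf_greatest)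
    fix e assume "e \<in> S"
    then have "Inf ((\<lambda>e. e + ereal \<tau>) ` S) \<le> e + ereal \<tau>"
      by (rule INF_lower)
    then show "Inf ((\<lambda>e. e + ereal \<tau>) ` S) - ereal \<tau> \<le> e"
      by (simp add: ereal_minus_le)
  qed
  then show "Inf ((\<lambda>e. e + ereal \<tau>) ` S) \<le> Inf S + ereal \<tau>"
    by (simp add: ereal_minus_le)
  show "Inf S + ereal \<tau> \<le> Inf ((\<lambda>e. e + ereal \<tau>) ` S)"
    by (intro INF_greatest add_right_mono Inf_lower)
qed

text \<open>The time \<open>s\<close> is an extended real because T_2 is sought after T_1, which is
  \<infinity> if there is no further transmission.\<close>

lemma next_after_translate:
  "next_after ((+) \<tau> ` A) (s + ereal \<tau>) = next_after A s + ereal \<tau>"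
proof -
  have "s + ereal \<tau> < ereal (\<tau> + a) \<longleftrightarrow> s < ereal a" for a
    by (cases s) (auto simp: add.commute)
  then have "{ereal t |t. t \<in> (+) \<tau> ` A \<and> s + ereal \<tau> < ereal t}
      = (\<lambda>e. e + ereal \<tau>) ` {ereal t |t. t \<in> A \<and> s < ereal t}"
    by (fastforce simp: image_iff add.commute)
  then show ?thesis
    by (simp add: next_after_def Inf_add_ereal)
qed

lemma next_after_nonneg: "0 \<le> s \<Longrightarrow> 0 \<le> next_after A s"
  unfolding next_after_def by (intro Inf_greatest) (auto intro: order_trans less_imp_le)

section \<open>Effect of a first event on mixing\<close>

context
  fixes A :: "device \<times> activity \<Rightarrow> real set" and \<tau> :: real and p :: "device \<times> activity"
  assumes pos: "\<And>j a. a \<in> A j \<Longrightarrow> 0 < a" and \<tau>: "0 < \<tau>"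
begin

text \<open>Seen from a time at or after \<tau>, the new point is not strictly later, so only the
  translation remains.\<close>

lemma next_after_prepend_point_shift:
  assumes "0 \<le> s"
  shows "next_after (prepend_point p \<tau> A j) (s + ereal \<tau>) = next_after (A j) s + ereal \<tau>"
proof -
  have "\<not> s + ereal \<tau> < ereal \<tau>"
    using assms by (cases s) auto
  then show ?thesis
    by (simp add: prepend_point_def next_after_insert next_after_translate)
qed

lemma next_after_prepend_point_0:
  "next_after (prepend_point p \<tau> A j) 0 = (if j = p then ereal \<tau> else next_after (A j) 0 + ereal \<tau>)"
proof -
  have "next_after ((+) \<tau> ` A j) 0 = next_after ((+) \<tau> ` A j) (0 + ereal \<tau>)"
    using pos[of _ j] \<tau> by (intro next_after_gt_eq) auto
  also have "\<dots> = next_after (A j) 0 + ereal \<tau>"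
    by (rule next_after_translate)
  finally have *: "next_after ((+) \<tau> ` A j) 0 = next_after (A j) 0 + ereal \<tau>" .
  have "ereal \<tau> \<le> next_after (A j) 0 + ereal \<tau>"
    using next_after_nonneg[of 0 "A j"] by (cases "next_after (A j) 0") auto
  then show ?thesis
    using \<tau> * by (cases "j = p") (simp_all add: prepend_point_def next_after_insert min_absorb1)
qed

lemma ereal_add_le_diff_iff: "a + ereal \<tau> \<le> ereal t \<longleftrightarrow> a \<le> ereal (t - \<tau>)"
  by (cases a) auto

lemma ereal_add_less_add_iff: "a + ereal \<tau> < b + ereal \<tau> \<longleftrightarrow> a < b"
  by (cases a; cases b) auto

text \<open>Mixing at \<open>\<tau> + s\<close> depends only on points strictly after that time.
  These are translated points, and the translation shortens the horizon to
  \<open>t - \<tau>\<close>.\<close>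

lemma mixes_at_prepend_point_shift:
  assumes "0 \<le> s"
  shows "mixes_at (\<lambda>d. prepend_point p \<tau> A (d, Randomize)) (\<lambda>d. prepend_point p \<tau> A (d, Transmit)) t i (\<tau> + s)
    \<longleftrightarrow> mixes_at (\<lambda>d. A (d, Randomize)) (\<lambda>d. A (d, Transmit)) (t - \<tau>) i s"
proof -
  have s: "0 \<le> ereal s" and eq: "ereal (\<tau> + s) = ereal s + ereal \<tau>"
    using assms by auto
  show ?thesis
    unfolding mixes_at_def Let_def eq next_after_prepend_point_shift[OF s]
      next_after_prepend_point_shift[OF next_after_nonneg[OF s]]
      ereal_add_le_diff_iff ereal_add_less_add_iff ..
qed

text \<open>All points lie at or after \<tau>, hence beyond the horizon, whereas every way of mixing
  requires a randomization within it.\<close>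

lemma not_mixes_from_prepend_point:
  assumes "t < \<tau>"
  shows "\<not> mixes_from c (prepend_point p \<tau> A) t"
proof -
  have "\<not> next_after (prepend_point p \<tau> A j) 0 \<le> ereal t" for j
    using assms next_after_nonneg[of 0 "A j"]
    by (cases "next_after (A j) 0") (auto simp: next_after_prepend_point_0)
  moreover have "t < a" if "a \<in> prepend_point p \<tau> A j" for a j
    using that assms pos[of _ j] by (fastforce simp: prepend_point_def split: if_splits)
  ultimately show ?thesis
    by (fastforce simp: mixes_from_def mixes_within_def mixes_at_def Let_def zero_ereal_def
        split: pending.splits)
qed

text \<open>Mixing on the extended path uses a translated opportunity, the one created at \<tau>, or
  the pending one. Each is accounted for by \<open>c'\<close>; contrapositively, survival from
  \<open>c'\<close> within \<open>t - \<tau>\<close> gives survival from \<open>c\<close> within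
  \<open>t\<close>.\<close>

lemma mixes_from_prepend_point:
  assumes "mixes_from c (prepend_point p \<tau> A) t" and step: "pending_after c p = Some c'"
  shows "mixes_from c' A (t - \<tau>)"
proof -
  let ?P = "prepend_point p \<tau> A"
  have shift0: "mixes_at (\<lambda>d. ?P (d, Randomize)) (\<lambda>d. ?P (d, Transmit)) t i \<tau>
    \<longleftrightarrow> mixes_at (\<lambda>d. A (d, Randomize)) (\<lambda>d. A (d, Transmit)) (t - \<tau>) i 0" for i
    using mixes_at_prepend_point_shift[of 0] by simp
  consider "mixes_within (\<lambda>d. ?P (d, Randomize)) (\<lambda>d. ?P (d, Transmit)) t"
    | i where "c = Fresh i" "mixes_at (\<lambda>d. ?P (d, Randomize)) (\<lambda>d. ?P (d, Transmit)) t i 0"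
    | i where "c = Half i" "next_after (?P (other i, Randomize)) 0 \<le> ereal t"
        "next_after (?P (other i, Randomize)) 0 < next_after (?P (other i, Transmit)) 0"
    using assms(1) by (auto simp: mixes_from_def split: pending.splits)
  then show ?thesis
  proof cases
    case 1
    then obtain i s where s: "s \<in> ?P (i, Randomize)" "0 \<le> s" "s \<le> t"
      and mix: "mixes_at (\<lambda>d. ?P (d, Randomize)) (\<lambda>d. ?P (d, Transmit)) t i s"
      by (auto simp: mixes_within_def)
    show ?thesis
    proof (cases "s \<in> (+) \<tau> ` A (i, Randomize)")
      case True
      then obtain a where a: "a \<in> A (i, Randomize)" "s = \<tau> + a" by auto
      have "0 < a"
        using a(1) by (rule pos)
      then have "mixes_at (\<lambda>d. A (d, Randomize)) (\<lambda>d. A (d, Transmit)) (t - \<tau>) i a"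
        using mix a mixes_at_prepend_point_shift[of a] by auto
      then show ?thesis
        using a s \<open>0 < a\<close> unfolding mixes_from_def mixes_within_def
        by (intro disjI1 exI[of _ i] bexI[of _ a]) auto
    next
      case False
      \<comment> \<open>The only opportunity at \<tau> itself is a randomization of
        \<open>i\<close>, after which every state other than \<open>None\<close> is
        \<open>Fresh i\<close>.\<close>
      then have "s = \<tau>" "p = (i, Randomize)"
        using s by (auto simp: prepend_point_def split: if_splits)
      moreover from this have "c' = Fresh i"
        using step by (cases c) (auto split: if_splits)
      ultimately show ?thesis
        using mix shift0[of i] by (simp add: mixes_from_def)
    qed
  next
    case (2 i)
    have ne: "i \<noteq> other i"
      by (cases i) auto
    \<comment> \<open>If \<open>i\<close> transmits at \<tau>, then T_1 is \<tau> and T_2 is sought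
      from time 0 of the restarted path, as in \<open>Half i\<close>. Otherwise T_1 is merely
      translated, as in \<open>Fresh i\<close>.\<close>
    have T\<^sub>2: "next_after (?P j) (next_after (?P (i, Transmit)) 0) =
        (if (i, Transmit) = p then next_after (A j) 0
         else next_after (A j) (next_after (A (i, Transmit)) 0)) + ereal \<tau>" for j
      using next_after_prepend_point_shift[of 0 j]
        next_after_prepend_point_shift[of "next_after (A (i, Transmit)) 0" j]
      by (simp add: next_after_prepend_point_0 next_after_nonneg)
    have mix: "next_after (?P (other i, Randomize)) 0 \<le> ereal t"
      "next_after (?P (other i, Randomize)) 0
        < next_after (?P (other i, Transmit)) (next_after (?P (i, Transmit)) 0)"
      using 2(2) by (simp_all add: mixes_at_def Let_def zero_ereal_def[symmetric])
    consider "p = (i, Randomize)" | "p = (other i, Randomize)" | "p = (i, Transmit)" | "p = (other i, Transmit)"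
      by (cases p; cases "fst p"; cases "snd p"; cases i) auto
    then show ?thesis
      using mix[unfolded T\<^sub>2, unfolded next_after_prepend_point_0] 2(1) step ne
      by cases (auto simp: mixes_from_def mixes_at_def Let_def ereal_add_le_diff_iff
          ereal_add_less_add_iff zero_ereal_def[symmetric])
  next
    case (3 i)
    have ne: "i \<noteq> other i"
      by (cases i) auto
    \<comment> \<open>If the other device transmits first, mixing at the pending opportunity would
      require this impossible inequality. The opportunity is dead, so passing to \<open>Idle\<close>
      loses nothing.\<close>
    have less: "\<not> next_after (A j) 0 + ereal \<tau> < ereal \<tau>" for j
      using next_after_nonneg[of 0 "A j"] by (cases "next_after (A j) 0") auto
    \<comment> \<open>If \<open>i\<close> randomizes again, the state becomes
      \<open>Fresh i\<close>. There T_2 is sought only after a T_1 still to come, so the condition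
      for mixing is weaker than in \<open>Half i\<close> and covers it.\<close>
    have "0 \<le> next_after (A (i, Transmit)) 0"
      by (rule next_after_nonneg) simp
    then have le: "next_after (A j) 0 \<le> next_after (A j) (next_after (A (i, Transmit)) 0)" for j
      by (rule next_after_mono)
    consider "p = (i, Randomize)" | "p = (other i, Randomize)" | "p = (i, Transmit)" | "p = (other i, Transmit)"
      by (cases p; cases "fst p"; cases "snd p"; cases i) auto
    then show ?thesis
      using 3(2,3)[unfolded next_after_prepend_point_0] 3(1) step ne
      by cases (auto simp: mixes_from_def mixes_at_def Let_def ereal_add_le_diff_iff less
          ereal_add_less_add_iff zero_ereal_def[symmetric] intro: less_le_trans[OF _ le])
  qed
qed

end

section \<open>Survival probabilities\<close>

definition points :: "('i \<Rightarrow> nat \<Rightarrow> real) \<Rightarrow> 'i \<Rightarrow> real set" where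
  "points x j = range (\<lambda>n. \<Sum>k\<le>n. x j k)"

lemma arrival_times_eq_points: "arrival_times (X j) \<omega> = points (\<lambda>j n. X j n \<omega>) j"
  by (simp add: arrival_times_def arrival_def points_def)

lemma points_pos:
  assumes "\<And>j n. 0 < x j n" "a \<in> points x j"
  shows "0 < a"
  using assms by (auto simp: points_def intro!: sum_pos)

lemma points_prepend_event: "points (prepend_event p \<tau> x) = prepend_point p \<tau> (points x)"
proof
  fix j
  show "points (prepend_event p \<tau> x) j = prepend_point p \<tau> (points x) j"
  proof (cases "j = p")
    case True
    \<comment> \<open>Index shift: the partial sum at 0 is \<tau> itself, and the one at
      \<open>Suc m\<close> is \<tau> plus the old one at \<open>m\<close>.\<close>
    have sums: "(\<Sum>k\<le>n. case_nat \<tau> (x p) k) = case_nat \<tau> (\<lambda>m. \<tau> + (\<Sum>k\<le>m. x p k)) n" for n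
      by (cases n) (simp_all add: sum.atMost_Suc_shift del: sum.atMost_Suc)
    have "range (case_nat \<tau> g) = insert \<tau> (range g)" for g :: "nat \<Rightarrow> real"
      by (subst UNIV_nat_eq) (simp add: image_image)
    with True show ?thesis
      by (auto simp: points_def prepend_event_def prepend_point_def sums)
  next
    case False
    have "(\<Sum>k\<le>n. ((x j)(0 := x j 0 + \<tau>)) k) = \<tau> + (\<Sum>k\<le>n. x j k)" for n
      by (induction n) auto
    with False show ?thesis
      by (auto simp: points_def prepend_event_def prepend_point_def delay_def)
  qed
qed

lemma UNIV_device_activity:
  "UNIV = {(Device1, Randomize), (Device1, Transmit), (Device2, Randomize), (Device2, Transmit)}"
proof -
  have "p \<in> {(Device1, Randomize), (Device1, Transmit), (Device2, Randomize), (Device2, Transmit)}" for p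
    by (cases p; cases "fst p"; cases "snd p") auto
  then show ?thesis by blast
qed

lemma finite_device_activity: "finite (UNIV :: (device \<times> activity) set)"
  by (simp add: UNIV_device_activity)

definition survival :: "pending \<Rightarrow> real \<Rightarrow> (device \<times> activity \<Rightarrow> nat \<Rightarrow> real) set" where
  "survival c t = {x. \<not> mixes_from c (points x) t}"

text \<open>Each of the countably many intervals avoids the null point 0. This supplies the
  positivity of points assumed when an event is prepended.\<close>

lemma AE_clocks_pos:
  assumes "\<And>i :: 'i. 0 < rate i" "finite (UNIV :: 'i set)"
  shows "AE x in clocks rate. \<forall>i n. 0 < x i n"
proof -
  have expo: "AE y in expo l. 0 < y" if "0 < l" for l
    unfolding expo_def using AE_lborel_singleton[of 0]
    by (subst AE_density) (auto elim!: eventually_mono simp: exponential_density_def)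
  have "AE z in gaps l. 0 < z n" if "0 < l" for l n
    unfolding gaps_def using that by (intro AE_PiM_component prob_space_expo expo) auto
  then have "AE x in clocks rate. 0 < x i n" for i n
    unfolding clocks_def using assms(1) by (intro AE_PiM_component prob_space_gaps) auto
  then have "AE x in clocks rate. \<forall>n. 0 < x i n" for i
    by (simp add: AE_all_countable)
  then have "AE x in clocks rate. \<forall>i\<in>UNIV. \<forall>n. 0 < x i n"
    by (intro AE_finite_allI assms(2)) auto
  then show ?thesis by simp
qed

lemma measurable_next_after_points [measurable (raw)]:
  assumes [measurable]: "f \<in> N \<rightarrow>\<^sub>M clocks rate" "s \<in> borel_measurable N"
  shows "(\<lambda>x. next_after (points (f x) j) (s x)) \<in> borel_measurable N"
  using measurable_next_after[of "\<lambda>n x. f x j n" N s]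
  by (simp add: arrival_times_def arrival_def points_def)

lemma survival_sets [measurable]: "survival c t \<in> sets (clocks rate)"
proof -
  let ?Y = "\<lambda>j n (x :: device \<times> activity \<Rightarrow> nat \<Rightarrow> real). x j n"
  have Y [measurable]: "?Y j n \<in> borel_measurable (clocks rate)" for j n
    by measurable
  have points: "arrival_times (?Y j) x = points x j" for j x
    by (rule arrival_times_eq_points)
  have "{x. mixes_within (\<lambda>d. points x (d, Randomize)) (\<lambda>d. points x (d, Transmit)) t} \<in> sets (clocks rate)"
    using mix_event_sets[where X = ?Y and T = t, OF Y] by (simp add: mix_event_def points)
  then have [measurable]: "Measurable.pred (clocks rate)
      (\<lambda>x. mixes_within (\<lambda>d. points x (d, Randomize)) (\<lambda>d. points x (d, Transmit)) t)"
    by (simp add: pred_def)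
  have "{x \<in> space (clocks rate). \<not> mixes_from c (points x) t} \<in> sets (clocks rate)"
    by (cases c) (simp_all only: mixes_from_def mixes_at_def Let_def pending.case, measurable)
  then show ?thesis
    by (simp add: survival_def)
qed

section \<open>Rates, weights and the generator inequality\<close>

fun rates :: "real \<Rightarrow> real \<Rightarrow> device \<times> activity \<Rightarrow> real" where
  "rates l\<^sub>r l\<^sub>t (d, Randomize) = l\<^sub>r"
| "rates l\<^sub>r l\<^sub>t (d, Transmit) = l\<^sub>t"

text \<open>
  With \<open>q = l\<^sub>t / (l\<^sub>r + l\<^sub>t)\<close>, the weight is the probability that the pending opportunity
  dies without mixing when the horizon is infinite.
\<close>

fun weight :: "real \<Rightarrow> pending \<Rightarrow> real" where
  "weight q Idle = 1"
| "weight q (Fresh i) = q\<^sup>2"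
| "weight q (Half i) = q"

text \<open>\<open>None\<close> counts as 0 because no survival is left after mixing.\<close>

definition step_weight :: "real \<Rightarrow> pending \<Rightarrow> device \<times> activity \<Rightarrow> real" where
  "step_weight q c p = (case pending_after c p of None \<Rightarrow> 0 | Some c' \<Rightarrow> weight q c')"

lemma sum_rates: "(\<Sum>p\<in>UNIV. rates l\<^sub>r l\<^sub>t p) = 2 * (l\<^sub>r + l\<^sub>t)"
  by (simp add: UNIV_device_activity)

text \<open>
  The generator inequality: it makes \<open>weight q c * exp (- 2 * l\<^sub>r * (1 - q\<^sup>2) * t)\<close> a
  subsolution of the backward equation for the probability of not mixing within \<open>t\<close>.
\<close>

lemma step_weight_ge:
  assumes "0 < l\<^sub>r" "0 < l\<^sub>t" and q: "q = l\<^sub>t / (l\<^sub>r + l\<^sub>t)"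
  shows "(2 * (l\<^sub>r + l\<^sub>t) - 2 * l\<^sub>r * (1 - q\<^sup>2)) * weight q c \<le> (\<Sum>p\<in>UNIV. rates l\<^sub>r l\<^sub>t p * step_weight q c p)"
proof -
  have l_t: "l\<^sub>t = (l\<^sub>r + l\<^sub>t) * q"
    using assms by simp
  have q01: "0 < q" "q < 1"
    using assms by simp_all
  show ?thesis
  proof (cases c)
    \<comment> \<open>Equality holds in this case, which fixes the decay rate
      \<open>2 * l\<^sub>r * (1 - q\<^sup>2)\<close>.\<close>
    case Idle
    then show ?thesis
      by (simp add: UNIV_device_activity step_weight_def algebra_simps)
  next
    case (Fresh i)
    have "(\<Sum>p\<in>UNIV. rates l\<^sub>r l\<^sub>t p * step_weight q c p) = l\<^sub>r * q\<^sup>2 + l\<^sub>t * q + l\<^sub>t * q\<^sup>2"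
      using Fresh by (cases i) (simp_all add: UNIV_device_activity step_weight_def)
    \<comment> \<open>The last summand vanishes by the choice of \<open>q\<close>, since
      \<open>(l\<^sub>r + l\<^sub>t) * q = l\<^sub>t\<close>; the remainder is nonnegative because
      \<open>q\<close> lies between 0 and 1. The case \<open>Half\<close> is arranged in the same
      way.\<close>
    moreover have "l\<^sub>r * q\<^sup>2 + l\<^sub>t * q + l\<^sub>t * q\<^sup>2 - (2 * (l\<^sub>r + l\<^sub>t) - 2 * l\<^sub>r * (1 - q\<^sup>2)) * q\<^sup>2
        = 2 * l\<^sub>r * (q\<^sup>2 * (1 - q\<^sup>2)) + (l\<^sub>t - (l\<^sub>r + l\<^sub>t) * q) * q"
      by (simp add: algebra_simps power2_eq_square)
    moreover have "0 \<le> 2 * l\<^sub>r * (q\<^sup>2 * (1 - q\<^sup>2))"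
      using q01 assms by (simp add: power_le_one)
    ultimately show ?thesis
      using Fresh l_t by simp
  next
    case (Half i)
    have "(\<Sum>p\<in>UNIV. rates l\<^sub>r l\<^sub>t p * step_weight q c p) = l\<^sub>r * q\<^sup>2 + l\<^sub>t * q + l\<^sub>t"
      using Half by (cases i) (simp_all add: UNIV_device_activity step_weight_def)
    moreover have "l\<^sub>r * q\<^sup>2 + l\<^sub>t * q + l\<^sub>t - (2 * (l\<^sub>r + l\<^sub>t) - 2 * l\<^sub>r * (1 - q\<^sup>2)) * q
        = l\<^sub>r * q * (1 - q) * (1 + 2 * q) + (l\<^sub>t - (l\<^sub>r + l\<^sub>t) * q)"
      by (simp add: algebra_simps power2_eq_square)
    moreover have "0 \<le> l\<^sub>r * q * (1 - q) * (1 + 2 * q)"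
      using q01 assms by simp
    ultimately show ?thesis
      using Half l_t by simp
  qed
qed

text \<open>Ringing times up to \<open>t\<close> contribute
  \<open>a * (exp (- g * t) - exp (- L * t))\<close>. Those beyond \<open>t\<close>, where survival
  is certain, contribute \<open>exp (- L * t)\<close>, which leaves the surplus
  \<open>(1 - a) * exp (- L * t)\<close>.\<close>

lemma nn_integral_first_event_profile:
  assumes "0 \<le> t" "0 < L" "g \<le> L" "0 \<le> a"
  shows "ennreal (a * exp (- g * t) + (1 - a) * exp (- L * t))
    \<le> (\<integral>\<^sup>+\<tau>. ennreal (exp (- L * \<tau>) * (if t < \<tau> then L else (L - g) * (a * exp (- g * (t - \<tau>)))))
        * indicator {0<..} \<tau> \<partial>lborel)"
proof -
  \<comment> \<open>\<open>?F\<close> and \<open>?G\<close> are antiderivatives of \<open>?f\<close>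
    and \<open>?h\<close>, which are the integrand before and after \<open>t\<close>.\<close>
  let ?F = "\<lambda>\<tau>. - a * exp (- g * t) * exp (- (L - g) * \<tau>)"
  let ?f = "\<lambda>\<tau>. (L - g) * (a * exp (- g * t)) * exp (- (L - g) * \<tau>)"
  let ?G = "\<lambda>\<tau>. - exp (- L * \<tau>)"
  let ?h = "\<lambda>\<tau>. L * exp (- L * \<tau>)"
  have f: "(\<integral>\<^sup>+\<tau>. ennreal (?f \<tau>) * indicator {0..t} \<tau> \<partial>lborel) = ennreal (?F t - ?F 0)"
  proof (rule nn_integral_FTC_Icc)
    show "(?F has_real_derivative ?f \<tau>) (at \<tau>)" for \<tau>
      by (auto intro!: derivative_eq_intros simp: algebra_simps)
  qed (use assms in auto)
  have "((\<lambda>\<tau>. exp (- L * \<tau>)) \<longlongrightarrow> 0) at_top"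
    using \<open>0 < L\<close> by real_asymp
  then have "(?G \<longlongrightarrow> 0) at_top"
    by (auto intro: tendsto_eq_intros)
  then have h: "(\<integral>\<^sup>+\<tau>. ennreal (?h \<tau>) * indicator {t..} \<tau> \<partial>lborel) = ennreal (0 - ?G t)"
    using assms by (intro nn_integral_FTC_atLeast) (auto intro!: derivative_eq_intros)
  have "exp (- g * t) * exp (- (L - g) * t) = exp (- L * t)"
    by (simp add: exp_add[symmetric] algebra_simps)
  then have F: "?F t - ?F 0 = a * exp (- g * t) - a * exp (- L * t)"
    by (simp add: algebra_simps)
  have "exp (- L * t) \<le> exp (- g * t)"
    using assms by (simp add: mult_right_mono)
  then have F_nonneg: "0 \<le> ?F t - ?F 0"
    unfolding F using assms by (simp add: mult_left_mono)
  have total: "a * exp (- g * t) + (1 - a) * exp (- L * t) = (?F t - ?F 0) + (0 - ?G t)"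
    unfolding F by (simp add: algebra_simps)
  have "ennreal (a * exp (- g * t) + (1 - a) * exp (- L * t)) = ennreal (?F t - ?F 0) + ennreal (0 - ?G t)"
    unfolding total by (intro ennreal_plus F_nonneg) simp
  also have "\<dots> = (\<integral>\<^sup>+\<tau>. ennreal (?f \<tau>) * indicator {0..t} \<tau> + ennreal (?h \<tau>) * indicator {t..} \<tau> \<partial>lborel)"
    unfolding f[symmetric] h[symmetric] by (rule nn_integral_add[symmetric]) auto
  also have "\<dots> = (\<integral>\<^sup>+\<tau>. ennreal (exp (- L * \<tau>) * (if t < \<tau> then L else (L - g) * (a * exp (- g * (t - \<tau>)))))
        * indicator {0<..} \<tau> \<partial>lborel)"
  proof (rule nn_integral_cong_AE)
    have eq: "?f \<tau> = exp (- L * \<tau>) * ((L - g) * (a * exp (- g * (t - \<tau>))))" for \<tau>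
    proof -
      have "?f \<tau> = (L - g) * a * (exp (- g * t) * exp (- (L - g) * \<tau>))"
        by (simp only: mult_ac)
      also have "exp (- g * t) * exp (- (L - g) * \<tau>) = exp (- L * \<tau>) * exp (- g * (t - \<tau>))"
        by (simp add: exp_add[symmetric] algebra_simps)
      finally show ?thesis
        by (simp only: mult_ac)
    qed
    \<comment> \<open>The closed integration ranges contain 0 and overlap at \<open>t\<close>; both
      points are null.\<close>
    show "AE \<tau> in lborel. ennreal (?f \<tau>) * indicator {0..t} \<tau> + ennreal (?h \<tau>) * indicator {t..} \<tau>
      = ennreal (exp (- L * \<tau>) * (if t < \<tau> then L else (L - g) * (a * exp (- g * (t - \<tau>)))))
        * indicator {0<..} \<tau>"
      using AE_lborel_singleton[of 0] AE_lborel_singleton[of t]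
    proof eventually_elim
      case (elim \<tau>)
      then show ?case
        using \<open>0 \<le> t\<close> unfolding eq by (auto simp: indicator_def mult.commute)
    qed
  qed
  finally show ?thesis by simp
qed

section \<open>Iterating the renewal inequality\<close>

context
  fixes l\<^sub>r l\<^sub>t q \<gamma> :: real
  assumes l\<^sub>r: "0 < l\<^sub>r" and l\<^sub>t: "0 < l\<^sub>t"
  defines "q \<equiv> l\<^sub>t / (l\<^sub>r + l\<^sub>t)" and "\<gamma> \<equiv> 2 * l\<^sub>r * (1 - q\<^sup>2)"
begin

private abbreviation "\<mu> \<equiv> clocks (rates l\<^sub>r l\<^sub>t)"
private abbreviation "L \<equiv> 2 * (l\<^sub>r + l\<^sub>t)"

lemma rates_pos: "0 < rates l\<^sub>r l\<^sub>t p"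
  using l\<^sub>r l\<^sub>t by (cases p; cases "snd p") auto

lemma q_bounds: "0 < q" "q < 1"
  using l\<^sub>r l\<^sub>t by (simp_all add: q_def)

lemma weight_bounds: "0 \<le> weight q c" "weight q c \<le> 1"
  using q_bounds by (cases c; simp add: power_le_one)+

lemma gamma_bounds: "0 \<le> \<gamma>" "\<gamma> \<le> L"
proof -
  show "0 \<le> \<gamma>"
    using q_bounds l\<^sub>r by (simp add: \<gamma>_def power_le_one)
  have "l\<^sub>r * (1 - q\<^sup>2) \<le> l\<^sub>r"
    using l\<^sub>r by (simp add: algebra_simps)
  then show "\<gamma> \<le> L"
    using l\<^sub>t by (simp add: \<gamma>_def)
qed

text \<open>
  The increment \<open>exp (- L * T)\<close> comes from the event that no clock rings up to time \<open>T\<close>;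
  iterating the step drives \<open>k\<close> to \<open>1\<close>.
\<close>

lemma survival_bound_step:
  assumes k: "0 \<le> k" "k \<le> 1" and t: "0 \<le> t" "t \<le> T"
    and IH: "\<And>c t. 0 \<le> t \<Longrightarrow> t \<le> T \<Longrightarrow> ennreal (k * weight q c * exp (- \<gamma> * t)) \<le> emeasure \<mu> (survival c t)"
  shows "ennreal ((k + exp (- L * T) * (1 - k)) * weight q c * exp (- \<gamma> * t)) \<le> emeasure \<mu> (survival c t)"
proof -
  interpret prob_space \<mu>
    by (intro prob_space_clocks rates_pos)
  \<comment> \<open>Lower bound for survival when \<open>p\<close> rings first, at \<tau>: certain
    if \<tau> is beyond the horizon, otherwise the assumed bound for the successor state, and 0 for
    \<open>None\<close>.\<close>
  let ?g = "\<lambda>p \<tau>. if t < \<tau> then 1 else k * step_weight q c p * exp (- \<gamma> * (t - \<tau>))"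
  have step_weight_nonneg: "0 \<le> step_weight q c p" for p
    using weight_bounds by (auto simp: step_weight_def split: option.split)
  have post: "ennreal (?g p \<tau>) \<le> (\<integral>\<^sup>+x. indicator (survival c t) (prepend_event p \<tau> x) \<partial>\<mu>)"
    if "0 < \<tau>" for p \<tau>
  proof (cases "t < \<tau>")
    case True
    have "AE x in \<mu>. (1 :: ennreal) \<le> indicator (survival c t) (prepend_event p \<tau> x)"
      using AE_clocks_pos[OF rates_pos finite_device_activity]
    proof eventually_elim
      case (elim x)
      have pos: "0 < a" if "a \<in> points x j" for a j
        using points_pos[OF _ that] elim by blast
      have "prepend_event p \<tau> x \<in> survival c t"
        using not_mixes_from_prepend_point[OF pos \<open>0 < \<tau>\<close> True, where p = p and c = c]
        by (simp add: survival_def points_prepend_event)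
      then show ?case by simp
    qed
    then have "(\<integral>\<^sup>+x. 1 \<partial>\<mu>) \<le> (\<integral>\<^sup>+x. indicator (survival c t) (prepend_event p \<tau> x) \<partial>\<mu>)"
      by (rule nn_integral_mono_AE)
    then show ?thesis
      using True emeasure_space_1 by simp
  next
    case False
    show ?thesis
    proof (cases "pending_after c p")
      case None
      then show ?thesis
        using False by (simp add: step_weight_def)
    next
      case (Some c')
      have "AE x in \<mu>. (indicator (survival c' (t - \<tau>)) x :: ennreal)
          \<le> indicator (survival c t) (prepend_event p \<tau> x)"
        using AE_clocks_pos[OF rates_pos finite_device_activity]
      proof eventually_elim
        case (elim x)
        have pos: "0 < a" if "a \<in> points x j" for a j
          using points_pos[OF _ that] elim by blast
        have "prepend_event p \<tau> x \<in> survival c t" if "x \<in> survival c' (t - \<tau>)"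
          using that mixes_from_prepend_point[OF pos \<open>0 < \<tau>\<close> _ Some, where t = t]
          by (auto simp: survival_def points_prepend_event)
        then show ?case
          by (auto simp: indicator_def)
      qed
      then have "(\<integral>\<^sup>+x. indicator (survival c' (t - \<tau>)) x \<partial>\<mu>)
          \<le> (\<integral>\<^sup>+x. indicator (survival c t) (prepend_event p \<tau> x) \<partial>\<mu>)"
        by (rule nn_integral_mono_AE)
      moreover have "ennreal (k * weight q c' * exp (- \<gamma> * (t - \<tau>))) \<le> emeasure \<mu> (survival c' (t - \<tau>))"
        using False that t by (intro IH) auto
      ultimately show ?thesis
        using False Some by (auto simp: step_weight_def)
    qed
  qed
  define a where "a = k * weight q c"
  have a: "0 \<le> a" "a \<le> k"
    using k weight_bounds[of c] by (auto simp: a_def mult_left_le)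
  have "(k + exp (- L * T) * (1 - k)) * weight q c * exp (- \<gamma> * t)
      = a * exp (- \<gamma> * t) + (exp (- L * T) * (1 - k)) * (weight q c * exp (- \<gamma> * t))"
    by (simp add: a_def algebra_simps)
  \<comment> \<open>As \<open>t \<le> T\<close> and \<open>a \<le> k\<close>, the surplus is at
    least the claimed gain. Measuring the gain at \<open>T\<close> makes it independent of
    \<open>t\<close>, so the step can be iterated on the whole interval.\<close>
  also have "\<dots> \<le> a * exp (- \<gamma> * t) + (exp (- L * t) * (1 - a)) * 1"
    using k a t l\<^sub>r l\<^sub>t weight_bounds[of c] gamma_bounds
    by (intro add_left_mono mult_mono) (auto intro!: mult_le_one)
  finally have "ennreal ((k + exp (- L * T) * (1 - k)) * weight q c * exp (- \<gamma> * t))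
      \<le> ennreal (a * exp (- \<gamma> * t) + (1 - a) * exp (- L * t))"
    by (intro ennreal_leI) (simp add: mult.commute)
  also have "\<dots> \<le> (\<integral>\<^sup>+\<tau>. ennreal (exp (- L * \<tau>) * (if t < \<tau> then L else (L - \<gamma>) * (a * exp (- \<gamma> * (t - \<tau>)))))
        * indicator {0<..} \<tau> \<partial>lborel)"
    using t l\<^sub>r l\<^sub>t gamma_bounds a by (intro nn_integral_first_event_profile) auto
  \<comment> \<open>Up to the horizon the generator inequality replaces
    \<open>(L - \<gamma>) * weight q c\<close> by a sum over the four clocks; beyond it both sides
    carry the total rate \<open>L\<close>.\<close>
  also have "\<dots> \<le> (\<integral>\<^sup>+\<tau>. (\<Sum>p\<in>UNIV. ennreal (rates l\<^sub>r l\<^sub>t p * exp (- L * \<tau>)) * ennreal (?g p \<tau>)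
        * indicator {0<..} \<tau>) \<partial>lborel)"
  proof (intro nn_integral_mono)
    fix \<tau> :: real
    have "(if t < \<tau> then L else (L - \<gamma>) * (a * exp (- \<gamma> * (t - \<tau>)))) \<le> (\<Sum>p\<in>UNIV. rates l\<^sub>r l\<^sub>t p * ?g p \<tau>)"
    proof (cases "t < \<tau>")
      case True
      then show ?thesis by (simp add: sum_rates)
    next
      case False
      have "(L - \<gamma>) * weight q c \<le> (\<Sum>p\<in>UNIV. rates l\<^sub>r l\<^sub>t p * step_weight q c p)"
        unfolding \<gamma>_def by (rule step_weight_ge[OF l\<^sub>r l\<^sub>t]) (simp add: q_def)
      then have "(L - \<gamma>) * weight q c * (k * exp (- \<gamma> * (t - \<tau>)))
          \<le> (\<Sum>p\<in>UNIV. rates l\<^sub>r l\<^sub>t p * step_weight q c p) * (k * exp (- \<gamma> * (t - \<tau>)))"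
        using k by (intro mult_right_mono) auto
      moreover have "(L - \<gamma>) * weight q c * (k * exp (- \<gamma> * (t - \<tau>))) = (L - \<gamma>) * (a * exp (- \<gamma> * (t - \<tau>)))"
        by (simp only: a_def mult_ac)
      moreover have "(\<Sum>p\<in>UNIV. rates l\<^sub>r l\<^sub>t p * step_weight q c p) * (k * exp (- \<gamma> * (t - \<tau>)))
          = (\<Sum>p\<in>UNIV. rates l\<^sub>r l\<^sub>t p * (k * step_weight q c p * exp (- \<gamma> * (t - \<tau>))))"
        by (simp only: sum_distrib_right) (simp only: mult_ac)
      ultimately show ?thesis
        using False by (simp only: if_False)
    qed
    then have "exp (- L * \<tau>) * (if t < \<tau> then L else (L - \<gamma>) * (a * exp (- \<gamma> * (t - \<tau>))))
        \<le> exp (- L * \<tau>) * (\<Sum>p\<in>UNIV. rates l\<^sub>r l\<^sub>t p * ?g p \<tau>)"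
      by (rule mult_left_mono) simp
    also have "\<dots> = (\<Sum>p\<in>UNIV. rates l\<^sub>r l\<^sub>t p * exp (- L * \<tau>) * ?g p \<tau>)"
      by (simp only: sum_distrib_left) (simp only: mult_ac)
    finally have "ennreal (exp (- L * \<tau>) * (if t < \<tau> then L else (L - \<gamma>) * (a * exp (- \<gamma> * (t - \<tau>)))))
        \<le> ennreal (\<Sum>p\<in>UNIV. rates l\<^sub>r l\<^sub>t p * exp (- L * \<tau>) * ?g p \<tau>)"
      by (rule ennreal_leI)
    also have "\<dots> = (\<Sum>p\<in>UNIV. ennreal (rates l\<^sub>r l\<^sub>t p * exp (- L * \<tau>) * ?g p \<tau>))"
      using k less_imp_le[OF rates_pos] step_weight_nonneg by (intro sum_ennreal[symmetric]) auto
    also have "\<dots> = (\<Sum>p\<in>UNIV. ennreal (rates l\<^sub>r l\<^sub>t p * exp (- L * \<tau>)) * ennreal (?g p \<tau>))"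
      using k less_imp_le[OF rates_pos] step_weight_nonneg by (intro sum.cong refl ennreal_mult) auto
    finally show "ennreal (exp (- L * \<tau>) * (if t < \<tau> then L else (L - \<gamma>) * (a * exp (- \<gamma> * (t - \<tau>)))))
        * indicator {0<..} \<tau>
      \<le> (\<Sum>p\<in>UNIV. ennreal (rates l\<^sub>r l\<^sub>t p * exp (- L * \<tau>)) * ennreal (?g p \<tau>) * indicator {0<..} \<tau>)"
      by (simp only: sum_distrib_right[symmetric] mult_right_mono zero_le)
  qed
  also have "\<dots> = (\<Sum>p\<in>UNIV. \<integral>\<^sup>+\<tau>. ennreal (rates l\<^sub>r l\<^sub>t p * exp (- L * \<tau>)) * ennreal (?g p \<tau>)
        * indicator {0<..} \<tau> \<partial>lborel)"
    by (rule nn_integral_sum) (rule borel_measurable_exp_profile)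
  also have "\<dots> \<le> (\<Sum>p\<in>UNIV. \<integral>\<^sup>+\<tau>. ennreal (rates l\<^sub>r l\<^sub>t p * exp (- (\<Sum>j\<in>UNIV. rates l\<^sub>r l\<^sub>t j) * \<tau>)) *
        (\<integral>\<^sup>+x. indicator (survival c t) (prepend_event p \<tau> x) \<partial>\<mu>) * indicator {0<..} \<tau> \<partial>lborel)"
    unfolding sum_rates
  proof (intro sum_mono nn_integral_mono)
    fix p :: "device \<times> activity" and \<tau> :: real
    show "ennreal (rates l\<^sub>r l\<^sub>t p * exp (- L * \<tau>)) * ennreal (?g p \<tau>) * indicator {0<..} \<tau>
      \<le> ennreal (rates l\<^sub>r l\<^sub>t p * exp (- L * \<tau>)) *
        (\<integral>\<^sup>+x. indicator (survival c t) (prepend_event p \<tau> x) \<partial>\<mu>) * indicator {0<..} \<tau>"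
    proof (cases "0 < \<tau>")
      case True
      then show ?thesis
        by (intro mult_right_mono mult_left_mono post) simp_all
    qed simp
  qed
  also have "\<dots> \<le> (\<integral>\<^sup>+x. indicator (survival c t) x \<partial>\<mu>)"
    by (rule nn_integral_clocks_ge_first_event[OF rates_pos finite_device_activity]) measurable
  also have "\<dots> = emeasure \<mu> (survival c t)"
    by (rule nn_integral_indicator) measurable
  finally show ?thesis .
qed

lemma survival_bound:
  assumes "0 \<le> t"
  shows "weight q c * exp (- \<gamma> * t) \<le> measure \<mu> (survival c t)"
proof -
  interpret prob_space \<mu>
    by (intro prob_space_clocks rates_pos)
  define d where "d = exp (- L * t)"
  have "0 \<le> L * t"
    using assms l\<^sub>r l\<^sub>t by simp
  then have d: "0 < d" "d \<le> 1"
    unfolding d_def by (simp_all only: exp_gt_zero exp_le_one_iff mult_minus_left neg_le_0_iff_le)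
  \<comment> \<open>Starting from the trivial bound with \<open>k = 0\<close>, the recursion
    \<open>k + d * (1 - k)\<close> has the solution \<open>1 - (1 - d) ^ n\<close>. All
    \<open>s\<close> up to \<open>t\<close> share the same \<open>d\<close>, since the step uses the
    bound on the whole interval.\<close>
  have iterate: "ennreal ((1 - (1 - d) ^ n) * weight q c' * exp (- \<gamma> * s)) \<le> emeasure \<mu> (survival c' s)"
    if "0 \<le> s" "s \<le> t" for n c' s
    using that
  proof (induction n arbitrary: c' s)
    case 0
    then show ?case by simp
  next
    case (Suc n)
    have "1 - (1 - d) ^ Suc n = (1 - (1 - d) ^ n) + exp (- L * t) * (1 - (1 - (1 - d) ^ n))"
      by (simp add: d_def algebra_simps)
    then show ?case
      using Suc d by (simp only:) (intro survival_bound_step[where T = t]; auto simp: power_le_one)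
  qed
  have bound: "(1 - (1 - d) ^ n) * weight q c * exp (- \<gamma> * t) \<le> measure \<mu> (survival c t)" for n
    using iterate[of t n c] assms by (simp add: emeasure_eq_measure ennreal_le_iff)
  have "(\<lambda>n. (1 - (1 - d) ^ n) * weight q c * exp (- \<gamma> * t))
      \<longlonglongrightarrow> (1 - 0) * weight q c * exp (- \<gamma> * t)"
    using d by (intro tendsto_intros LIMSEQ_power_zero) auto
  then have "(1 - 0) * weight q c * exp (- \<gamma> * t) \<le> measure \<mu> (survival c t)"
    by (rule LIMSEQ_le_const2) (use bound in blast)
  then show ?thesis by simp
qed

end

section \<open>Transfer from the given processes to the canonical space\<close>

lemma distr_eq_gaps:
  assumes "prob_space M" and X: "iid_exponential M l X"
  shows "distr M (PiM UNIV (\<lambda>_. borel)) (\<lambda>\<omega> n. X n \<omega>) = gaps l"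
proof -
  interpret prob_space M by fact
  have D: "distributed M lborel (X n) (exponential_density l)" for n
    using X by (simp add: iid_exponential_def)
  have X_meas: "X n \<in> borel_measurable M" for n
    using distributed_measurable[OF D[of n]] by simp
  have "distr M (PiM UNIV (\<lambda>_. borel)) (\<lambda>\<omega>. \<lambda>n\<in>UNIV. X n \<omega>) = PiM UNIV (\<lambda>n. distr M borel (X n))"
    using X X_meas indep_vars_iff_distr_eq_PiM'[where I = UNIV and M' = "\<lambda>_. borel" and X = X]
    by (simp add: iid_exponential_def)
  moreover have "distr M borel (X n) = expo l" for n
    using distributed_distr_eq_density[OF D[of n]] by (simp add: expo_def cong: distr_cong)
  ultimately show ?thesis
    by (simp add: gaps_def restrict_UNIV)
qed

lemma device_processes_iid:
  assumes "device_processes M l\<^sub>r l\<^sub>t X"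
  shows "iid_exponential M (rates l\<^sub>r l\<^sub>t p) (X p)"
  using assms by (cases p; cases "snd p") (auto simp: device_processes_def)

lemma measurable_device_processes:
  assumes "device_processes M l\<^sub>r l\<^sub>t X"
  shows "(\<lambda>\<omega> n. X p n \<omega>) \<in> M \<rightarrow>\<^sub>M PiM UNIV (\<lambda>_. borel)"
proof (rule measurable_PiM_single')
  show "X p n \<in> borel_measurable M" for n
    using device_processes_iid[OF assms, of p]
    by (auto simp: iid_exponential_def dest!: spec[of _ n] distributed_measurable)
qed auto

text \<open>Independence enters on two levels: intervals within a process give \<open>gaps\<close>,
  and the four processes give the product of these laws. Mixing probabilities can thus be computed
  on the canonical space.\<close>

lemma distr_eq_clocks:
  assumes "prob_space M" and X: "device_processes M l\<^sub>r l\<^sub>t X"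
  shows "distr M (clocks (rates l\<^sub>r l\<^sub>t)) (\<lambda>\<omega> p n. X p n \<omega>) = clocks (rates l\<^sub>r l\<^sub>t)"
proof -
  interpret prob_space M by fact
  have "distr M (PiM UNIV (\<lambda>_. PiM UNIV (\<lambda>_. borel))) (\<lambda>\<omega>. \<lambda>p\<in>UNIV. (\<lambda>n. X p n \<omega>))
      = PiM UNIV (\<lambda>p. distr M (PiM UNIV (\<lambda>_. borel)) (\<lambda>\<omega> n. X p n \<omega>))"
    using X measurable_device_processes[OF X]
      indep_vars_iff_distr_eq_PiM'[where I = UNIV and M' = "\<lambda>_. PiM UNIV (\<lambda>_. borel)"
        and X = "\<lambda>p \<omega> n. X p n \<omega>"]
    by (simp add: device_processes_def)
  then have "distr M (PiM UNIV (\<lambda>_. PiM UNIV (\<lambda>_. borel))) (\<lambda>\<omega> p n. X p n \<omega>) = clocks (rates l\<^sub>r l\<^sub>t)"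
    by (simp add: clocks_def restrict_UNIV distr_eq_gaps[OF \<open>prob_space M\<close> device_processes_iid[OF X]])
  \<comment> \<open>The target of \<open>distr\<close> matters only through its sigma-algebra, which
    \<open>clocks\<close> shares with the product of Borel spaces.\<close>
  then show ?thesis
    using distr_cong[OF refl sets_clocks refl, of M "rates l\<^sub>r l\<^sub>t"] by metis
qed

theorem theorem2:
  fixes M :: "'a measure"
    and X :: "device \<times> activity \<Rightarrow> nat \<Rightarrow> 'a \<Rightarrow> real"
    and l\<^sub>r l\<^sub>t T :: real
  assumes "prob_space M"
    and "l\<^sub>r > 0" and "l\<^sub>t > 0" and "T > 0"
    and "device_processes M l\<^sub>r l\<^sub>t X"
  shows "p_mix M X T \<le> 1 - exp (- 2 * l\<^sub>r * T * p_mix1_ub l\<^sub>r l\<^sub>t)"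
proof -
  interpret prob_space M by fact
  let ?\<mu> = "clocks (rates l\<^sub>r l\<^sub>t)"
  let ?\<xi> = "\<lambda>\<omega> p n. X p n \<omega>"
  define q where "q = l\<^sub>t / (l\<^sub>r + l\<^sub>t)"
  have meas: "?\<xi> \<in> M \<rightarrow>\<^sub>M ?\<mu>"
    unfolding measurable_cong_sets[OF refl sets_clocks]
    by (rule measurable_PiM_single') (auto intro: measurable_device_processes[OF assms(5)] simp: space_PiM)
  have "survival Idle T = {x. \<not> mixes_within (\<lambda>d. points x (d, Randomize)) (\<lambda>d. points x (d, Transmit)) T}"
    by (simp add: survival_def mixes_from_def)
  then have vimage: "?\<xi> -` survival Idle T \<inter> space M = space M - mix_event M X T"
    by (auto simp: mix_event_def arrival_times_eq_points)
  \<comment> \<open>Dividing \<open>l\<^sub>r\<close> and \<open>l\<^sub>t\<close> by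
    \<open>l\<^sub>r + l\<^sub>t\<close> gives \<open>1 - q\<close> and \<open>q\<close>, so the
    quantity is \<open>(1 - q) * (1 + q)\<close>.\<close>
  have "p_mix1_ub l\<^sub>r l\<^sub>t = 1 - q\<^sup>2"
  proof -
    have "l\<^sub>r = (l\<^sub>r + l\<^sub>t) * (1 - q)" "l\<^sub>t / (l\<^sub>r + l\<^sub>t)\<^sup>2 = q / (l\<^sub>r + l\<^sub>t)"
      using assms(2,3) by (simp_all add: q_def field_simps power2_eq_square)
    then have "p_mix1_ub l\<^sub>r l\<^sub>t = (l\<^sub>r + l\<^sub>t) * (1 - q) * (1 / (l\<^sub>r + l\<^sub>t) + q / (l\<^sub>r + l\<^sub>t))"
      by (simp add: p_mix1_ub_def Let_def)
    also have "\<dots> = (1 - q) * (1 + q)"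
      using assms(2,3) by (simp add: add_divide_distrib[symmetric])
    finally show ?thesis
      by (simp add: algebra_simps power2_eq_square)
  qed
  then have "exp (- 2 * l\<^sub>r * T * p_mix1_ub l\<^sub>r l\<^sub>t) = weight q Idle * exp (- (2 * l\<^sub>r * (1 - q\<^sup>2)) * T)"
    by (simp only: weight.simps) (simp add: mult_ac)
  also have "\<dots> \<le> measure ?\<mu> (survival Idle T)"
    unfolding q_def using assms by (intro survival_bound) auto
  also have "\<dots> = measure (distr M ?\<mu> ?\<xi>) (survival Idle T)"
    by (simp only: distr_eq_clocks[OF assms(1,5)])
  also have "\<dots> = measure M (space M - mix_event M X T)"
    by (subst measure_distr[OF meas]) (simp_all add: vimage)
  also have "\<dots> = 1 - p_mix M X T"
    using device_processes_mix_event_sets[OF assms(5)] by (simp add: p_mix_def prob_compl)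
  finally show ?thesis by simp
qed

end
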